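(* Let $S\subset\mathbb{R}$ be a measurable set of finite Lebesgue measure with periodic gaps, and let $Q\subset\mathbb{R}$ be a measurable set of density zero. Then the pair $(S,Q)$ is weakly annihilating.
   Context: $|\cdot|$ denotes Lebesgue measure on $\mathbb{R}$. The Fourier transform is normalized as $\widehat f(\xi)=\mathcal{F}f(\xi)=\int_{\mathbb{R}}e^{-2\pi i x\xi}f(x)\,dx$ (extended to $L^2(\mathbb{R})$ as usual). A set $S\subset\mathbb{R}$ has periodic gaps if there are an interval $I$ (of positive length) and a number $T>0$ such that $I+kT\subset S^c=\mathbb{R}\setminus S$ for all $k\in\mathbb{Z}$. A set $Q\subset\mathbb{R}$ is of density zero if $|Q\cap(-r,r)|=o(r)$ as $r\to\infty$. For a function $f$, $\mathrm{supp}(f)=\{x\in\mathbb{R}: f(x)\neq 0\}$ and $\mathrm{spec}(f)=\mathrm{supp}(\widehat f)$; for $f\in L^2(\mathbb{R})$ inclusions of these sets are understood up to Lebesgue-null sets. A pair $(S,Q)$ of measurable sets is weakly annihilating if every $f\in L^2(\mathbb{R})$ with $\mathrm{supp}(f)\subset S$ and $\mathrm{spec}(f)\subset Q$ is $0$ (as an element of $L^2(\mathbb{R})$). *)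

theory Defs
  imports "HOL-Analysis.Analysis" "HOL-Library.Landau_Symbols"
begin

definition has_periodic_gaps :: "real set \<Rightarrow> bool" where
  "has_periodic_gaps S \<longleftrightarrow>
     (\<exists>I T. is_interval I \<and> emeasure lebesgue I > 0 \<and> T > 0 \<and>
        (\<forall>k::int. (\<lambda>x. x + of_int k * T) ` I \<subseteq> - S))"

definition density_zero :: "real set \<Rightarrow> bool" where
  "density_zero Q \<longleftrightarrow> (\<lambda>r. measure lebesgue (Q \<inter> {-r<..<r})) \<in> o[at_top](\<lambda>r. r)"

definition square_integrable :: "(real \<Rightarrow> complex) \<Rightarrow> bool" where
  "square_integrable f \<longleftrightarrow>
     f \<in> borel_measurable lebesgue \<and> integrable lebesgue (\<lambda>x. (cmod (f x))\<^sup>2)"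

text \<open>Convergence in \<open>L\<^sup>2\<close> uses the nonnegative integral, because the Bochner integral of a
  non-integrable function is 0.\<close>

definition L2_tendsto :: "(nat \<Rightarrow> real \<Rightarrow> complex) \<Rightarrow> (real \<Rightarrow> complex) \<Rightarrow> bool" where
  "L2_tendsto u f \<longleftrightarrow>
     (\<lambda>n. \<integral>\<^sup>+ x. ennreal ((cmod (u n x - f x))\<^sup>2) \<partial>lebesgue) \<longlonglongrightarrow> 0"

definition fourier_integral :: "(real \<Rightarrow> complex) \<Rightarrow> real \<Rightarrow> complex" where
  "fourier_integral f \<xi> =
     (LINT x|lebesgue. exp (- 2 * of_real pi * \<i> * of_real x * of_real \<xi>) * f x)"

text \<open>For an integrable function the transform is the integral. For any other function in
  \<open>L\<^sup>2\<close> it is (a representative of) the value of the extension by continuity from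
  \<open>L\<^sup>1 \<inter> L\<^sup>2\<close>, which exists and is unique almost everywhere by Plancherel's theorem.
  On \<open>L\<^sup>1 \<inter> L\<^sup>2\<close> the two descriptions agree almost everywhere.\<close>

definition fourier :: "(real \<Rightarrow> complex) \<Rightarrow> real \<Rightarrow> complex" where
  "fourier f =
     (if integrable lebesgue f then fourier_integral f
      else (SOME g. square_integrable g \<and>
              (\<forall>u. (\<forall>n. integrable lebesgue (u n) \<and> square_integrable (u n)) \<longrightarrow>
                   L2_tendsto u f \<longrightarrow> L2_tendsto (\<lambda>n. fourier_integral (u n)) g)))"

text \<open>The support is the set of nonzeros itself, without closure.\<close>

definition supp :: "(real \<Rightarrow> complex) \<Rightarrow> real set" where
  "supp f = {x. f x \<noteq> 0}"

definition spec :: "(real \<Rightarrow> complex) \<Rightarrow> real set" where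
  "spec f = supp (fourier f)"

definition ae_subset :: "real set \<Rightarrow> real set \<Rightarrow> bool" where
  "ae_subset A B \<longleftrightarrow> A - B \<in> null_sets lebesgue"

definition weakly_annihilating :: "real set \<Rightarrow> real set \<Rightarrow> bool" where
  "weakly_annihilating S Q \<longleftrightarrow>
     (\<forall>f. square_integrable f \<and> ae_subset (supp f) S \<and> ae_subset (spec f) Q \<longrightarrow>
          (AE x in lebesgue. f x = 0))"

end

theory Submission
  imports Defs "HOL-Probability.Probability" "HOL-Real_Asymp.Real_Asymp"
begin

text \<open>
  A function \<open>f\<close> in \<open>L\<^sup>2\<close> that lives on a set of finite measure is integrable, so its transform \<open>F\<close>
  is a continuous function given by the integral. The proof shows that \<open>F\<close> vanishes at every
  point, by a quantitative uncertainty principle on the lattices \<open>t + \<int> / T\<close>, where \<open>T\<close> is the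
  period of the gaps and \<open>c\<close> is the centre of one of them.

  Put \<open>w x = cis (- 2 * pi * (x - c) / T)\<close>. This function has period \<open>T\<close> and equals \<open>1\<close> exactly at the
  gap centres, so on \<open>S\<close> one has \<open>cmod (1 + w x) \<le> s\<close> for some \<open>s < 2\<close>. The trigonometric polynomial
  \<open>(1 + w) ^ (2 * N)\<close> is therefore at most \<open>s ^ (2 * N)\<close> on \<open>S\<close>, while its middle coefficient is
  about \<open>4 ^ N\<close>. Integrating it against \<open>f\<close> yields a combination of the \<open>2 * N + 1\<close> values
  \<open>F (t + n / T)\<close>, \<open>\<bar>n\<bar> \<le> N\<close>; if only the middle value were nonzero, it would be exponentially
  small. The other nonzero values are removed by multiplying the coefficient with index \<open>j\<close> by
  \<open>\<Prod>l\<in>A. (j - l)\<close>, where \<open>A\<close> is the set of indices other than \<open>N\<close> at which \<open>F\<close> does not vanish. This amounts to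
  applying \<open>card A\<close> first-order differential operators to the polynomial. With \<open>k = card A\<close>
  it costs a factor of at most \<open>(4 * N) ^ k\<close> in the upper bound
  (\<open>weighted_binomial_sum_bound\<close>), and the middle coefficient is multiplied by at least
  \<open>fact k / 2 ^ k\<close> (\<open>fact_card_le_prod_nonzero_ints\<close>). When \<open>k\<close> is at most a small multiple of \<open>N\<close>, the
  total loss \<open>(8 * N) ^ k / fact k\<close> is beaten by the gain \<open>(s / 2) ^ (2 * N)\<close>
  (\<open>sparse_factor_subexponential\<close>).

  If \<open>F\<close> were nonzero at a point, it would be bounded away from \<open>0\<close> on an interval around it. Since the
  spectrum has density zero, averaging over the interval gives for every large \<open>N\<close> a \<open>t\<close> in it with
  \<open>k \<le> \<epsilon> * N\<close> (\<open>density_zero_sparse_sample\<close>), and then \<open>F t\<close> is exponentially small in \<open>N\<close>, which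
  is a contradiction. That \<open>F = 0\<close> forces \<open>f = 0\<close> almost everywhere follows from the uniqueness
  theorem for characteristic functions.
\<close>

section \<open>Binomial sums with prescribed zero coefficients\<close>

text \<open>
  With \<open>a = 0\<close> this bounds \<open>(1 + w) ^ m\<close> after each factor \<open>j - l\<close> has been inserted into its
  coefficients, which corresponds to applying \<open>w d/dw - l\<close>. Such an operator turns
  \<open>w ^ a * (1 + w) ^ b\<close> into \<open>(a - l) * w ^ a * (1 + w) ^ b + b * w ^ (a + 1) * (1 + w) ^ (b - 1)\<close>,
  whence the family with \<open>a + b = m\<close> is stable under induction on \<open>A\<close>, and each step costs a
  factor \<open>2 * m\<close>.
\<close>

lemma weighted_binomial_sum_bound:
  fixes w :: complex and A :: "nat set" and s :: real
  assumes "finite A" "A \<subseteq> {..m}" "a + b = m"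
    and w: "cmod w \<le> 1" "cmod (1 + w) \<le> s" "1 \<le> s"
  shows "cmod (\<Sum>j\<le>b. of_nat (b choose j) * (\<Prod>l\<in>A. of_nat (j + a) - of_nat l) * w ^ j)
           \<le> (2 * real m) ^ card A * s ^ b"
  using assms(1-3)
proof (induction A arbitrary: a b rule: finite_induct)
  case empty
  have "(\<Sum>j\<le>b. of_nat (b choose j) * w ^ j) = (1 + w) ^ b"
    using binomial_ring[of w 1 b] by (simp add: add.commute)
  then show ?case
    using w by (simp add: norm_power power_mono)
next
  case (insert l A)
  define P where "P a j = (\<Prod>l\<in>A. (of_nat (j + a) - of_nat l :: complex))" for a j :: nat
  define F where "F a b = (\<Sum>j\<le>b. of_nat (b choose j) * P a j * w ^ j)" for a b
  have IH: "cmod (F a b) \<le> (2 * real m) ^ card A * s ^ b" if "a + b = m" for a b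
    using insert.IH[of a b] insert.prems that by (simp add: F_def P_def)
  have lm: "l \<le> m" using insert.prems by auto
  have split: "(\<Sum>j\<le>b. of_nat (b choose j) * (\<Prod>l\<in>insert l A. of_nat (j + a) - of_nat l) * w ^ j)
     = (of_nat a - of_nat l) * F a b + (\<Sum>j\<le>b. of_nat (j * (b choose j)) * P a j * w ^ j)"
    using insert.hyps
    by (simp add: F_def P_def sum_distrib_left flip: sum.distrib) (simp add: algebra_simps)
  have shift: "(\<Sum>j\<le>b. of_nat (j * (b choose j)) * P a j * w ^ j)
      = of_nat b * w * F (Suc a) (b - 1)"
  proof (cases b)
    case (Suc d)
    have "(\<Sum>j\<le>b. of_nat (j * (b choose j)) * P a j * w ^ j)
       = (\<Sum>j\<le>d. of_nat (Suc j * (Suc d choose Suc j)) * P a (Suc j) * w ^ Suc j)"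
      unfolding Suc by (subst sum.atMost_Suc_shift) simp
    also have "\<dots> = of_nat b * w * F (Suc a) (b - 1)"
      unfolding Suc F_def sum_distrib_left Suc_times_binomial
      by (intro sum.cong) (simp_all add: P_def algebra_simps)
    finally show ?thesis .
  qed simp
  have b1: "cmod ((of_nat a - of_nat l) * F a b) \<le> real m * ((2 * real m) ^ card A * s ^ b)"
  proof -
    have "cmod (of_nat a - of_nat l) = \<bar>real a - real l\<bar>"
      by (metis norm_of_real of_real_diff of_real_of_nat_eq)
    also have "\<dots> \<le> real m" using lm insert.prems by auto
    finally show ?thesis unfolding norm_mult
      using IH[of a b] insert.prems by (intro mult_mono) auto
  qed
  have b2: "cmod (of_nat b * w * F (Suc a) (b - 1)) \<le> real m * ((2 * real m) ^ card A * s ^ b)"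
  proof (cases b)
    case 0
    then show ?thesis using w by simp
  next
    case (Suc d)
    have "cmod (F (Suc a) d) \<le> (2 * real m) ^ card A * s ^ d"
      using IH[of "Suc a" d] insert.prems Suc by simp
    also have "\<dots> \<le> (2 * real m) ^ card A * s ^ b"
      using w Suc by (intro mult_left_mono power_increasing) auto
    finally have "cmod (of_nat b * w) * cmod (F (Suc a) d) \<le> real m * ((2 * real m) ^ card A * s ^ b)"
      using w insert.prems
      by (intro mult_mono) (auto simp: norm_mult intro: order_trans[OF mult_mono[of _ "real b" _ 1]])
    then show ?thesis using Suc by (simp add: norm_mult)
  qed
  have "cmod (\<Sum>j\<le>b. of_nat (b choose j) * (\<Prod>l\<in>insert l A. of_nat (j + a) - of_nat l) * w ^ j)
     \<le> real m * ((2 * real m) ^ card A * s ^ b) + real m * ((2 * real m) ^ card A * s ^ b)"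
    unfolding split shift by (rule order_trans[OF norm_triangle_ineq add_mono[OF b1 b2]])
  also have "\<dots> = (2 * real m) ^ card (insert l A) * s ^ b"
    using insert.hyps by (simp add: algebra_simps)
  finally show ?case .
qed

text \<open>
  The largest absolute value \<open>M\<close> in \<open>B\<close> satisfies \<open>card B \<le> 2 * M\<close>, because there are only \<open>2 * M\<close> nonzero
  integers in \<open>{-M..M}\<close>; removing it reduces both sides of the inequality accordingly.
\<close>
lemma fact_card_le_prod_nonzero_ints:
  fixes B :: "int set"
  assumes "finite B" "0 \<notin> B"
  shows "fact (card B) \<le> (\<Prod>b\<in>B. 2 * \<bar>b\<bar>)"
  using assms
proof (induction "card B" arbitrary: B)
  case 0
  then show ?case by simp
next
  case (Suc k)
  then have "B \<noteq> {}" by auto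
  define M where "M = Max (abs ` B)"
  have "M \<in> abs ` B" using Suc \<open>B \<noteq> {}\<close> by (simp add: M_def)
  then obtain b where b: "b \<in> B" "\<bar>b\<bar> = M" by auto
  have le: "\<bar>x\<bar> \<le> M" if "x \<in> B" for x using that Suc by (simp add: M_def)
  have "B \<subseteq> {-M..-1} \<union> {1..M}"
  proof
    fix x assume "x \<in> B"
    with le[of x] Suc.prems have "\<bar>x\<bar> \<le> M" "x \<noteq> 0" by auto
    then show "x \<in> {-M..-1} \<union> {1..M}" by auto
  qed
  then have "card B \<le> card ({-M..-1} \<union> {1..M})" by (intro card_mono) auto
  also have "\<dots> \<le> nat M + nat M"
    using card_Un_le[of "{-M..-1}" "{1..M}"] by simp
  finally have "int (card B) \<le> 2 * \<bar>b\<bar>" using b le[OF b(1)] by linarith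
  moreover have "fact (card (B - {b})) \<le> (\<Prod>b\<in>B - {b}. 2 * \<bar>b\<bar>)"
    using Suc b by (intro Suc.hyps) auto
  ultimately have "int (card B) * fact (card (B - {b})) \<le> (2 * \<bar>b\<bar>) * (\<Prod>b\<in>B - {b}. 2 * \<bar>b\<bar>)"
    by (intro mult_mono) auto
  also have "\<dots> = (\<Prod>b\<in>B. 2 * \<bar>b\<bar>)"
    using prod.remove[OF Suc.prems(1) b(1), of "\<lambda>b. 2 * \<bar>b\<bar>"] by simp
  also have "int (card B) * fact (card (B - {b})) = fact (card B)"
    using Suc.hyps(2) b Suc.prems by (simp flip: Suc.hyps(2))
  finally show ?case .
qed

section \<open>Elementary growth estimates\<close>

lemma power_over_fact_le_exp:
  fixes x :: real assumes "x \<ge> 0"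
  shows "x ^ k / fact k \<le> exp x"
proof -
  have s: "(\<lambda>n. x ^ n / fact n) sums exp x" using exp_converges[of x] by (simp add: divide_inverse mult.commute)
  have "sum (\<lambda>n. x ^ n / fact n) {k} \<le> (\<Sum>n. x ^ n / fact n)"
    using s assms by (intro sum_le_suminf) (auto simp: sums_iff)
  then show ?thesis using s by (simp add: sums_iff)
qed

text \<open>
  Writing \<open>8 * N = (1 / \<epsilon>) * (8 * \<epsilon> * N)\<close> and using \<open>x ^ k / fact k \<le> exp x\<close> bounds the first factor by
  \<open>exp (\<epsilon> * ln (1 / \<epsilon>) + 8 * \<epsilon>) ^ N\<close>, whose base tends to \<open>1\<close> as \<open>\<epsilon>\<close> tends to \<open>0\<close>.
\<close>
lemma sparse_factor_subexponential:
  fixes \<rho> :: real assumes "0 < \<rho>" "\<rho> < 1"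
  obtains \<epsilon> q :: real where "0 < \<epsilon>" "0 < q" "q < 1"
    "\<And>N k::nat. real k \<le> \<epsilon> * real N \<Longrightarrow> (8 * real N) ^ k / fact k * \<rho> ^ N \<le> q ^ N"
proof -
  have "((\<lambda>e::real. exp (e * ln (1/e) + 8 * e) * \<rho>) \<longlongrightarrow> exp 0 * \<rho>) (at_right 0)"
    by (intro tendsto_intros) real_asymp
  then have "\<forall>\<^sub>F e in at_right 0. exp (e * ln (1/e) + 8 * e) * \<rho> < (1::real)"
    using assms by (intro order_tendstoD(2)[where y="exp 0 * \<rho>"]) auto
  moreover have "\<forall>\<^sub>F e in at_right 0. e \<in> {0<..<1::real}" 
    by (rule eventually_at_right_real) simp
  ultimately have "\<forall>\<^sub>F e in at_right 0. exp (e * ln (1/e) + 8 * e) * \<rho> < (1::real) \<and> e \<in> {0<..<1}"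
    by (rule eventually_conj)
  then obtain e where e: "exp (e * ln (1/e) + 8 * e) * \<rho> < 1" "0 < e" "e < 1"
    using eventually_happens[of _ "at_right (0::real)"] by auto
  define q where "q = exp (e * ln (1/e) + 8 * e) * \<rho>"
  show thesis
  proof (rule that[of e q])
    fix N k :: nat assume k: "real k \<le> e * real N"
    have "(8 * real N) ^ k / fact k = (1/e) ^ k * ((8 * e * real N) ^ k / fact k)"
      using e by (simp add: power_mult_distrib power_one_over field_simps)
    also have "\<dots> \<le> exp (e * ln (1/e) * real N) * exp (8 * e * real N)"
    proof (rule mult_mono)
      have "(1/e) ^ k = exp (real k * ln (1/e))"
        using e by (subst exp_of_nat_mult) simp
      also have "\<dots> \<le> exp (e * real N * ln (1/e))"
        using k e by (auto intro!: mult_right_mono simp: ln_div)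
      finally show "(1/e) ^ k \<le> exp (e * ln (1/e) * real N)" by (simp add: mult_ac)
      show "(8 * e * real N) ^ k / fact k \<le> exp (8 * e * real N)"
        using e by (intro power_over_fact_le_exp) auto
    qed (use e in auto)
    also have "\<dots> = exp (e * ln (1/e) + 8 * e) ^ N"
      by (simp add: exp_of_nat_mult[symmetric] exp_add[symmetric] algebra_simps)
    finally show "(8 * real N) ^ k / fact k * \<rho> ^ N \<le> q ^ N"
      using assms unfolding q_def power_mult_distrib by (intro mult_right_mono) auto
  qed (use e assms in \<open>auto simp: q_def\<close>)
qed

section \<open>The Fourier integral of an integrable function\<close>

lemma kernel_eq_cis: "exp (- 2 * of_real pi * \<i> * of_real x * of_real \<xi>) = cis (- 2 * pi * x * \<xi>)"
  by (simp add: cis_conv_exp mult_ac)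

lemma integrable_kernel_mult:
  assumes "integrable lebesgue f"
  shows "integrable lebesgue (\<lambda>x. exp (- 2 * of_real pi * \<i> * of_real x * of_real \<xi>) * f x)"
proof (rule Bochner_Integration.integrable_bound[OF assms])
  have "(\<lambda>x::real. exp (- 2 * of_real pi * \<i> * of_real x * of_real \<xi>) :: complex) \<in> borel_measurable lebesgue"
    by (intro measurable_completion) measurable
  with assms show "(\<lambda>x. exp (- 2 * of_real pi * \<i> * of_real x * of_real \<xi>) * f x) \<in> borel_measurable lebesgue"
    by measurable
qed (simp add: kernel_eq_cis norm_mult)

lemma isCont_fourier_integral:
  assumes "integrable lebesgue f"
  shows "isCont (fourier_integral f) \<xi>"
  unfolding continuous_at_sequentially comp_def
proof (intro allI impI)
  fix u :: "nat \<Rightarrow> real" assume u: "u \<longlonglongrightarrow> \<xi>"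
  show "(\<lambda>n. fourier_integral f (u n)) \<longlonglongrightarrow> fourier_integral f \<xi>"
    unfolding fourier_integral_def
  proof (rule integral_dominated_convergence[where w="\<lambda>x. cmod (f x)"])
    show "AE x in lebesgue. (\<lambda>n. exp (- 2 * of_real pi * \<i> * of_real x * of_real (u n)) * f x)
        \<longlonglongrightarrow> exp (- 2 * of_real pi * \<i> * of_real x * of_real \<xi>) * f x"
      using u by (intro AE_I2 tendsto_intros)
  qed (use assms integrable_kernel_mult[OF assms] in \<open>auto simp: kernel_eq_cis norm_mult\<close>)
qed

lemma open_supp_fourier_integral:
  assumes "integrable lebesgue f"
  shows "open (supp (fourier_integral f))"
  unfolding supp_def
  by (intro open_Collect_neq continuous_at_imp_continuous_on ballI isCont_fourier_integral assms
      continuous_on_const)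

text \<open>
  The quantitative core. The sum of \<open>(2*N choose j) * (\<Prod>l\<in>A. j - l) * F (t + (j - N) / T)\<close>, with phases
  that move the origin to \<open>c\<close>, has only its middle term: the product vanishes for \<open>j\<close> in \<open>A\<close>, and \<open>F\<close>
  vanishes at the remaining sample points. The same sum is the integral of \<open>f\<close> against a
  trigonometric polynomial that is small where \<open>f\<close> is nonzero.
\<close>
lemma fourier_sample_bound:
  fixes f :: "real \<Rightarrow> complex" and A :: "nat set"
  assumes f: "integrable lebesgue f"
    and T: "T > 0"
    and s: "1 \<le> s" "AE x in lebesgue. f x \<noteq> 0 \<longrightarrow> cmod (1 + cis (- 2 * pi * (x - c) / T)) \<le> s"
    and A: "A \<subseteq> {..2*N}" "N \<notin> A"
    and zero: "\<And>j. j \<le> 2*N \<Longrightarrow> j \<noteq> N \<Longrightarrow> j \<notin> A \<Longrightarrow> fourier_integral f (t + (real j - real N) / T) = 0"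
  shows "fact (card A) * real (2*N choose N) * cmod (fourier_integral f t)
           \<le> (8 * real N) ^ card A * s ^ (2*N) * (LINT x|lebesgue. cmod (f x))"
proof -
  have "finite A" using A finite_subset by auto
  define C :: "nat \<Rightarrow> complex" where
    "C j = of_nat (2*N choose j) * (\<Prod>l\<in>A. of_nat j - of_nat l)" for j
  define e where "e \<xi> x = (exp (- 2 * of_real pi * \<i> * of_real x * of_real \<xi>) :: complex)" for x \<xi> :: real
  define \<xi> where "\<xi> j = t + (real j - real N) / T" for j
  define w where "w x = cis (- 2 * pi * (x - c) / T)" for x
  define d where "d j = C j * cis (2 * pi * c * real j / T)" for j :: nat
  have int: "integrable lebesgue (\<lambda>x. e (\<xi> j) x * f x)" for j
    unfolding e_def by (rule integrable_kernel_mult[OF f])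
  have FI: "fourier_integral f (\<xi> j) = (LINT x|lebesgue. e (\<xi> j) x * f x)" for j
    by (simp add: fourier_integral_def e_def)
  \<comment> \<open>The phase in \<open>d\<close> recentres the exponential at \<open>c\<close>, which makes the sum a polynomial in \<open>w x\<close>.\<close>
  have phase: "cis (2 * pi * c * real j / T) * e (\<xi> j) x = e (\<xi> 0) x * w x ^ j" for j x
    using T unfolding e_def kernel_eq_cis w_def \<xi>_def Complex.DeMoivre cis_mult
    by (intro arg_cong[where f=cis]) (simp add: field_simps)
  have "(\<Sum>j\<le>2*N. d j * fourier_integral f (\<xi> j)) = (\<Sum>j\<in>{N}. d j * fourier_integral f (\<xi> j))"
  proof (rule sum.mono_neutral_right)
    show "\<forall>j\<in>{..2*N} - {N}. d j * fourier_integral f (\<xi> j) = 0"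
    proof
      fix j assume j: "j \<in> {..2*N} - {N}"
      show "d j * fourier_integral f (\<xi> j) = 0"
      proof (cases "j \<in> A")
        case True
        then have "(\<Prod>l\<in>A. of_nat j - of_nat l :: complex) = 0"
          using \<open>finite A\<close> by (intro prod_zero) auto
        then show ?thesis by (simp add: d_def C_def)
      next
        case False
        then show ?thesis using zero j by (simp add: \<xi>_def)
      qed
    qed
  qed auto
  also have "\<dots> = d N * fourier_integral f t" by (simp add: \<xi>_def)
  finally have eq: "d N * fourier_integral f t
      = (LINT x|lebesgue. (\<Sum>j\<le>2*N. d j * (e (\<xi> j) x * f x)))"
    using int by (simp add: FI)
  have rewr: "(\<Sum>j\<le>2*N. d j * (e (\<xi> j) x * f x)) = e (\<xi> 0) x * f x * (\<Sum>j\<le>2*N. C j * w x ^ j)" for x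
  proof -
    have "d j * (e (\<xi> j) x * f x) = e (\<xi> 0) x * f x * (C j * w x ^ j)" for j
    proof -
      have "d j * (e (\<xi> j) x * f x) = C j * f x * (cis (2 * pi * c * real j / T) * e (\<xi> j) x)"
        by (simp add: d_def mult_ac)
      then show ?thesis unfolding phase by (simp add: mult_ac)
    qed
    then show ?thesis unfolding sum_distrib_left by (rule sum.cong[OF refl])
  qed
  let ?B = "(4 * real N) ^ card A * s ^ (2*N)"
  have "cmod (d N * fourier_integral f t) \<le> (LINT x|lebesgue. ?B * cmod (f x))"
    unfolding eq
  proof (rule order_trans[OF integral_norm_bound integral_mono_AE])
    show "integrable lebesgue (\<lambda>x. cmod (\<Sum>j\<le>2*N. d j * (e (\<xi> j) x * f x)))"
      using int by auto
    show "integrable lebesgue (\<lambda>x. ?B * cmod (f x))" using f by auto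
    show "AE x in lebesgue. cmod (\<Sum>j\<le>2*N. d j * (e (\<xi> j) x * f x)) \<le> ?B * cmod (f x)"
      using s(2)
    proof eventually_elim
      case (elim x)
      show ?case
      proof (cases "f x = 0")
        case False
        have "cmod (\<Sum>j\<le>2*N. C j * w x ^ j) \<le> ?B"
          using weighted_binomial_sum_bound[of A "2*N" 0 "2*N" "w x" s] False elim A s(1) \<open>finite A\<close>
          by (simp add: C_def w_def)
        then have "cmod (f x) * cmod (\<Sum>j\<le>2*N. C j * w x ^ j) \<le> cmod (f x) * ?B"
          by (intro mult_left_mono) auto
        then show ?thesis unfolding rewr by (simp add: norm_mult e_def kernel_eq_cis mult_ac)
      qed auto
    qed
  qed
  then have main: "cmod (C N) * cmod (fourier_integral f t) \<le> ?B * (LINT x|lebesgue. cmod (f x))"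
    by (simp add: norm_mult d_def)
  define B where "B = (\<lambda>l. int N - int l) ` A"
  have inj: "inj_on (\<lambda>l. int N - int l) A" by (auto simp: inj_on_def)
  have "fact (card A) \<le> (\<Prod>b\<in>B. 2 * \<bar>b\<bar>)"
    using fact_card_le_prod_nonzero_ints[of B] \<open>finite A\<close> A(2) card_image[OF inj] by (force simp: B_def)
  also have "\<dots> = 2 ^ card A * (\<Prod>l\<in>A. \<bar>int N - int l\<bar>)"
    unfolding B_def prod.reindex[OF inj] by (simp add: prod.distrib)
  finally have "real_of_int (fact (card A)) \<le> real_of_int (2 ^ card A * (\<Prod>l\<in>A. \<bar>int N - int l\<bar>))"
    by (simp only: of_int_le_iff)
  also have "\<dots> = 2 ^ card A * (\<Prod>l\<in>A. cmod (of_nat N - of_nat l))"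
  proof -
    have "cmod (of_nat N - of_nat l) = real_of_int \<bar>int N - int l\<bar>" for l
    proof -
      have "of_nat N - of_nat l = complex_of_real (real_of_int (int N - int l))" by simp
      then show ?thesis by (simp only: norm_of_real of_int_abs)
    qed
    then show ?thesis by simp
  qed
  finally have fact_le: "fact (card A) \<le> 2 ^ card A * (\<Prod>l\<in>A. cmod (of_nat N - of_nat l))" by simp
  have "fact (card A) * real (2*N choose N) * cmod (fourier_integral f t)
     \<le> (2 ^ card A * (\<Prod>l\<in>A. cmod (of_nat N - of_nat l))) * real (2*N choose N) * cmod (fourier_integral f t)"
    using fact_le by (intro mult_right_mono) auto
  also have "\<dots> = 2 ^ card A * (cmod (C N) * cmod (fourier_integral f t))"
    by (simp add: C_def norm_mult prod_norm mult_ac)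
  also have "\<dots> \<le> 2 ^ card A * (?B * (LINT x|lebesgue. cmod (f x)))"
    using main by (intro mult_left_mono) auto
  also have "\<dots> = (8 * real N) ^ card A * s ^ (2*N) * (LINT x|lebesgue. cmod (f x))"
  proof -
    have "(8 * real N) ^ card A = 2 ^ card A * (4 * real N) ^ card A"
      by (subst power_mult_distrib[symmetric]) simp
    then show ?thesis by (simp only: mult.assoc)
  qed
  finally show ?thesis .
qed

section \<open>Sampling a set of density zero\<close>

lemma density_zero_ae_subset:
  assumes "P \<in> sets lebesgue" "Q \<in> sets lebesgue" "ae_subset P Q" "density_zero Q"
  shows "density_zero P"
proof -
  have le: "measure lebesgue (P \<inter> {-r<..<r}) \<le> measure lebesgue (Q \<inter> {-r<..<r})" for r :: real
  proof -
    have fin: "Q \<inter> {-r<..<r} \<in> lmeasurable"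
      using assms(2) by (subst Int_commute) (intro fmeasurable_Int_fmeasurable; simp)
    have null: "P - Q \<in> null_sets lebesgue" using assms(3) by (simp add: ae_subset_def)
    have "measure lebesgue (P \<inter> {-r<..<r}) \<le> measure lebesgue ((Q \<inter> {-r<..<r}) \<union> (P - Q))"
      using assms fin null
      by (intro measure_mono_fmeasurable fmeasurable.Un fmeasurableI_null_sets[OF null]) auto
    also have "\<dots> = measure lebesgue (Q \<inter> {-r<..<r})"
      using fin null by (intro measure_Un_null_set) auto
    finally show ?thesis .
  qed
  then have "(\<lambda>r. measure lebesgue (P \<inter> {-r<..<r})) \<in> O[at_top](\<lambda>r. measure lebesgue (Q \<inter> {-r<..<r}))"
    by (intro landau_o.big_mono) auto
  then show ?thesis
    using assms(4) unfolding density_zero_def by (rule landau_o.big_small_trans)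
qed

text \<open>
  Integrating the number of sample points in \<open>P\<close> over all \<open>t\<close> in an interval of length \<open>2 * \<eta> \<le> 1 / T\<close>
  gives the measure of the part of \<open>P\<close> in a union of disjoint translates of that interval, all
  inside a window of size about \<open>N / T\<close>. Density zero makes this \<open>o(N)\<close>, so the number of points cannot
  exceed \<open>\<epsilon> * N\<close> for all \<open>t\<close>.
\<close>
lemma density_zero_sparse_sample:
  fixes P :: "real set"
  assumes P: "P \<in> sets lebesgue" "density_zero P"
    and "T > 0" "\<epsilon> > 0" "\<eta> > 0" "2 * \<eta> \<le> 1 / T"
  shows "\<forall>\<^sub>F N in sequentially. \<exists>t\<in>{t0 - \<eta><..<t0 + \<eta>}.
           real (card {j\<in>{..2*N}. t + (real j - real N) / T \<in> P}) \<le> \<epsilon> * real N"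
proof -
  define r where "r N = \<bar>t0\<bar> + \<eta> + real N / T" for N :: nat
  \<comment> \<open>For large \<open>N\<close> one has \<open>r N \<le> 2 * N / T\<close>, so \<open>\<delta> * r N \<le> \<epsilon> * \<eta> * N\<close>, which is half of what the
    negation of the claim requires.\<close>
  define \<delta> where "\<delta> = \<epsilon> * \<eta> * T / 2"
  have \<delta>: "\<delta> > 0" using assms by (simp add: \<delta>_def)
  have rlim: "filterlim r at_top sequentially"
    unfolding r_def using \<open>T > 0\<close> by real_asymp
  have "\<forall>\<^sub>F x in at_top. norm (measure lebesgue (P \<inter> {-x<..<x})) \<le> \<delta> * norm x"
    using landau_o.smallD[OF P(2)[unfolded density_zero_def] \<delta>] .
  then have "\<forall>\<^sub>F N in sequentially. norm (measure lebesgue (P \<inter> {- r N<..<r N})) \<le> \<delta> * norm (r N)"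
    using rlim by (rule eventually_compose_filterlim)
  moreover have "\<forall>\<^sub>F N in sequentially. \<bar>r N\<bar> \<le> 2 * real N / T"
    unfolding r_def using \<open>T > 0\<close> by real_asymp
  moreover have "\<forall>\<^sub>F N::nat in sequentially. N > 0" by (rule eventually_gt_at_top)
  ultimately show ?thesis
  proof eventually_elim
    case (elim N)
    show ?case
    proof (rule ccontr)
      assume no: "\<not> ?case"
      define J where "J = {t0 - \<eta><..<t0 + \<eta>}"
      define d where "d j = (real j - real N) / T" for j :: nat
      define W where "W j = P \<inter> (+) (d j) ` J" for j
      define K where "K j = (+) (- d j) ` W j" for j
      have K_eq: "K j = {t\<in>J. t + d j \<in> P}" for j
        by (force simp: K_def W_def image_iff algebra_simps)
      have W: "W j \<in> lmeasurable" for j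
        unfolding W_def J_def using P(1)
        by (simp only: Int_commute[of P]) (intro fmeasurable_Int_fmeasurable measurable_translation, auto)
      then have K: "K j \<in> lmeasurable" for j unfolding K_def by (rule measurable_translation)
      have "\<epsilon> * real N * (2 * \<eta>) = (LINT t|lebesgue. \<epsilon> * real N * indicator J t)"
        using assms by (simp add: J_def)
      also have "\<dots> \<le> (LINT t|lebesgue. (\<Sum>j\<le>2*N. indicator (K j) t))"
      proof (rule integral_mono)
        show "integrable lebesgue (\<lambda>t. \<epsilon> * real N * indicator J t)"
          by (intro integrable_mult_right integrable_real_indicator)
             (use fmeasurableD2[OF lmeasurable_box[of "t0 - \<eta>" "t0 + \<eta>"]] in \<open>auto simp: J_def less_top\<close>)
        show "integrable lebesgue (\<lambda>t. \<Sum>j\<le>2*N. indicat_real (K j) t)"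
          using K by (intro Bochner_Integration.integrable_sum integrable_real_indicator)
            (auto simp: fmeasurable_def simp del: emeasure_completion)
        fix t :: real
        have "\<epsilon> * real N \<le> (\<Sum>j\<le>2*N. indicator (K j) t)" if "t \<in> J"
        proof -
          have "(\<Sum>j\<le>2*N. indicat_real (K j) t) = real (card {j\<in>{..2*N}. t + d j \<in> P})"
            using that by (simp add: K_eq indicator_def sum.If_cases Int_def)
          moreover have "\<epsilon> * real N < real (card {j\<in>{..2*N}. t + d j \<in> P})"
            using no that by (auto simp: J_def d_def not_le)
          ultimately show ?thesis by simp
        qed
        then show "\<epsilon> * real N * indicator J t \<le> (\<Sum>j\<le>2*N. indicator (K j) t)"
          by (cases "t \<in> J") (auto intro: sum_nonneg)
      qed
      also have "\<dots> = (\<Sum>j\<le>2*N. measure lebesgue (K j))"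
        using K by (subst Bochner_Integration.integral_sum)
          (auto simp: fmeasurable_def simp del: emeasure_completion)
      also have "\<dots> = (\<Sum>j\<le>2*N. measure lebesgue (W j))"
        unfolding K_def measure_translation ..
      also have "\<dots> = measure lebesgue (\<Union>j\<le>2*N. W j)"
      proof (rule measure_finite_Union[symmetric])
        show "disjoint_family_on W {..2*N}"
          unfolding disjoint_family_on_def
        proof (intro ballI impI)
          fix i j :: nat assume "i \<noteq> j"
          have "\<bar>d i - d j\<bar> \<ge> 1 / T"
          proof -
            have "\<bar>real i - real j\<bar> \<ge> 1" using \<open>i \<noteq> j\<close> by linarith
            moreover have "d i - d j = (real i - real j) / T" by (simp add: d_def diff_divide_distrib)
            ultimately show ?thesis using \<open>T > 0\<close> by (simp add: abs_divide divide_right_mono)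
          qed
          then have "\<bar>d i - d j\<bar> \<ge> 2 * \<eta>" using assms by linarith
          then show "W i \<inter> W j = {}" by (auto simp: W_def J_def)
        qed
      qed (use W in \<open>auto simp: fmeasurable_def less_top simp del: emeasure_completion\<close>)
      also have "\<dots> \<le> measure lebesgue (P \<inter> {- r N<..<r N})"
      proof (rule measure_mono_fmeasurable)
        show "P \<inter> {- r N<..<r N} \<in> lmeasurable"
          using P(1) by (simp only: Int_commute[of P]) (intro fmeasurable_Int_fmeasurable, auto)
        show "(\<Union>j\<le>2*N. W j) \<subseteq> P \<inter> {- r N<..<r N}"
        proof
          fix x assume "x \<in> (\<Union>j\<le>2*N. W j)"
          then obtain j t where j: "j \<le> 2 * N" and t: "t \<in> J" "x = d j + t" and "x \<in> P"
            by (auto simp: W_def)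
          have "\<bar>real j - real N\<bar> \<le> real N" using j by linarith
          then have "\<bar>d j\<bar> \<le> real N / T"
            using \<open>T > 0\<close> by (simp add: d_def abs_divide divide_right_mono)
          moreover have "\<bar>t\<bar> < \<bar>t0\<bar> + \<eta>" using t(1) by (simp add: J_def) linarith
          ultimately have "\<bar>x\<bar> < r N" unfolding r_def t(2) by linarith
          with \<open>x \<in> P\<close> show "x \<in> P \<inter> {- r N<..<r N}" by (simp add: abs_less_iff)
        qed
      qed (use W in auto)
      also have "\<dots> \<le> \<delta> * \<bar>r N\<bar>" using elim by simp
      also have "\<dots> \<le> \<delta> * (2 * real N / T)" using elim \<delta> by (intro mult_left_mono) auto
      also have "\<dots> = \<epsilon> * \<eta> * real N" using \<open>T > 0\<close> by (simp add: \<delta>_def)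
      finally have "\<epsilon> * \<eta> * real N \<le> 0" by (simp add: algebra_simps)
      moreover have "\<epsilon> * \<eta> * real N > 0" using assms elim by simp
      ultimately show False by simp
    qed
  qed
qed

section \<open>Uniqueness for the Fourier integral\<close>

lemma integrable_iexp_mult:
  fixes g :: "real \<Rightarrow> complex"
  assumes "integrable lborel g"
  shows "integrable lborel (\<lambda>x. iexp (t * x) * g x)"
  by (rule Bochner_Integration.integrable_bound[OF assms])
     (use assms in \<open>auto simp: norm_mult\<close>)

text \<open>
  The positive and negative parts of \<open>g\<close> have equal transforms and, at \<open>t = 0\<close>, equal integrals \<open>a\<close>.
  If \<open>a\<close> is nonzero, dividing by \<open>a\<close> gives two probability densities with the same
  characteristic function, and Levy's uniqueness theorem applies.
\<close>
lemma real_function_zero_of_transform_zero: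
  fixes g :: "real \<Rightarrow> real"
  assumes g: "integrable lborel g"
    and zero: "\<And>t. (CLINT x|lborel. iexp (t * x) * of_real (g x)) = 0"
  shows "AE x in lborel. g x = 0"
proof -
  define p where "p x = max 0 (g x)" for x
  define n where "n x = max 0 (- g x)" for x
  have p: "integrable lborel p" and n: "integrable lborel n"
    unfolding p_def n_def using g by auto
  have [measurable]: "p \<in> borel_measurable borel" "n \<in> borel_measurable borel"
    using borel_measurable_integrable[OF p] borel_measurable_integrable[OF n] by simp_all
  have gpn: "g x = p x - n x" and pos: "0 \<le> p x" "0 \<le> n x" for x by (auto simp: p_def n_def)
  have eq: "(CLINT x|lborel. iexp (t * x) * of_real (p x)) = (CLINT x|lborel. iexp (t * x) * of_real (n x))" for t
  proof -
    have int: "integrable lborel (\<lambda>x. iexp (t * x) * of_real (p x))"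
         "integrable lborel (\<lambda>x. iexp (t * x) * of_real (n x))"
      using p n by (intro integrable_iexp_mult integrable_of_real; simp)+
    have "(CLINT x|lborel. iexp (t * x) * of_real (p x)) - (CLINT x|lborel. iexp (t * x) * of_real (n x))
        = (CLINT x|lborel. iexp (t * x) * of_real (g x))"
      unfolding Bochner_Integration.integral_diff[OF int, symmetric]
      by (simp add: gpn right_diff_distrib)
    with zero show ?thesis by simp
  qed
  define a where "a = integral\<^sup>L lborel p"
  have a_n: "integral\<^sup>L lborel n = a"
    using eq[of 0] by (simp add: a_def)
  have "a \<ge> 0" unfolding a_def using pos by (intro Bochner_Integration.integral_nonneg)
  show ?thesis
  proof (cases "a = 0")
    case True
    have "AE x in lborel. p x = 0" "AE x in lborel. n x = 0"
      using integral_nonneg_eq_0_iff_AE[OF p] integral_nonneg_eq_0_iff_AE[OF n] pos a_n True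
      by (auto simp: a_def)
    then show ?thesis by eventually_elim (simp add: gpn)
  next
    case False
    with \<open>a \<ge> 0\<close> have a: "a > 0" by simp
    have dist: "real_distribution (density lborel (\<lambda>x. ennreal (h x / a)))"
      if h: "integrable lborel h" "\<And>x. 0 \<le> h x" "integral\<^sup>L lborel h = a" for h
    proof -
      have [measurable]: "h \<in> borel_measurable borel" using borel_measurable_integrable[OF h(1)] by simp
      have "(\<integral>\<^sup>+x. ennreal (h x / a) \<partial>lborel) = ennreal (LINT x|lborel. h x / a)"
        using h a by (intro nn_integral_eq_integral) auto
      also have "\<dots> = 1" using h a by simp
      finally show ?thesis
        by (intro real_distribution.intro prob_spaceI real_distribution_axioms.intro)
           (auto simp: emeasure_density)
    qed
    have char: "char (density lborel (\<lambda>x. ennreal (h x / a))) t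
        = (CLINT x|lborel. iexp (t * x) * of_real (h x)) / a"
      if h: "integrable lborel h" "\<And>x. 0 \<le> h x" for h t
    proof -
      have [measurable]: "h \<in> borel_measurable borel" using borel_measurable_integrable[OF h(1)] by simp
      have "char (density lborel (\<lambda>x. ennreal (h x / a))) t = (CLINT x|lborel. (h x / a) *\<^sub>R iexp (t * x))"
        unfolding char_def using h a by (subst integral_density) auto
      also have "\<dots> = (CLINT x|lborel. (iexp (t * x) * of_real (h x)) / a)"
        by (simp add: scaleR_conv_of_real mult_ac)
      finally show ?thesis by simp
    qed
    have "density lborel (\<lambda>x. ennreal (p x / a)) = density lborel (\<lambda>x. ennreal (n x / a))"
      using dist[OF p] dist[OF n] char[OF p] char[OF n] pos a_n eq
      by (intro Levy_uniqueness) (auto simp: a_def)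
    then have "AE x in lborel. ennreal (p x / a) = ennreal (n x / a)"
      by (intro sigma_finite_measure.density_unique[OF sigma_finite_lborel]) auto
    then show ?thesis
    proof eventually_elim
      case (elim x)
      then have "p x / a = n x / a" using pos a by (subst (asm) ennreal_inj) auto
      then show ?case using a by (simp add: gpn)
    qed
  qed
qed

text \<open>
  The transforms \<open>U\<close> and \<open>V\<close> of the real and imaginary parts satisfy \<open>U t + \<i> * V t = 0\<close>. Conjugating this
  relation at \<open>- t\<close> gives \<open>U t - \<i> * V t = 0\<close>, since transforms of real functions are
  conjugate-symmetric; hence both vanish. Borel representatives \<open>u\<close> and \<open>v\<close> are needed because
  characteristic functions refer to Borel measures.
\<close>
lemma AE_zero_of_fourier_integral_zero:
  assumes f: "integrable lebesgue f" and zero: "\<And>\<xi>. fourier_integral f \<xi> = 0"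
  shows "AE x in lebesgue. f x = 0"
proof -
  have "(\<lambda>x. Re (f x)) \<in> borel_measurable lebesgue" "(\<lambda>x. Im (f x)) \<in> borel_measurable lebesgue"
    using f by auto
  from this[THEN completion_ex_borel_measurable_real] obtain u v where [measurable]: "u \<in> borel_measurable lborel" "v \<in> borel_measurable lborel"
    and uv0: "AE x in lborel. Re (f x) = u x" "AE x in lborel. Im (f x) = v x"
    by auto
  then have uv: "AE x in lebesgue. Re (f x) = u x" "AE x in lebesgue. Im (f x) = v x"
    by (auto intro: AE_completion)
  have uv_meas: "u \<in> borel_measurable lebesgue" "v \<in> borel_measurable lebesgue"
    by (rule measurable_completion, measurable)+
  have "integrable lebesgue u" "integrable lebesgue v"
    by (rule integrable_cong_AE_imp[OF integrable_Re[OF f] uv_meas(1) uv(1)],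
        rule integrable_cong_AE_imp[OF integrable_Im[OF f] uv_meas(2) uv(2)])
  then have iu: "integrable lborel u" and iv: "integrable lborel v"
    by (simp_all add: integrable_completion)
  define U where "U t = (CLINT x|lborel. iexp (t * x) * of_real (u x))" for t
  define V where "V t = (CLINT x|lborel. iexp (t * x) * of_real (v x))" for t
  have sum0: "U t + \<i> * V t = 0" for t
  proof -
    have "fourier_integral f (- t / (2 * pi)) = (CLINT x|lebesgue. iexp (t * x) * (of_real (u x) + \<i> * of_real (v x)))"
      unfolding fourier_integral_def
    proof (rule integral_cong_AE)
      show "AE x in lebesgue. exp (- 2 * of_real pi * \<i> * of_real x * of_real (- t / (2 * pi))) * f x
          = iexp (t * x) * (of_real (u x) + \<i> * of_real (v x))"
        using uv
      proof eventually_elim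
        case (elim x)
        then have "f x = of_real (u x) + \<i> * of_real (v x)" by (simp add: complex_eq_iff)
        then show ?case by (simp add: mult_ac)
      qed
      show "(\<lambda>x. iexp (t * x) * (of_real (u x) + \<i> * of_real (v x))) \<in> borel_measurable lebesgue"
        by (intro measurable_completion) measurable
    qed (rule borel_measurable_integrable[OF integrable_kernel_mult[OF f]])
    also have "\<dots> = (CLINT x|lborel. iexp (t * x) * (of_real (u x) + \<i> * of_real (v x)))"
      by (rule integral_completion) measurable
    also have "\<dots> = (CLINT x|lborel. iexp (t * x) * of_real (u x) + \<i> * (iexp (t * x) * of_real (v x)))"
      by (simp add: algebra_simps)
    also have "\<dots> = U t + \<i> * V t"
    proof -
      have iU: "integrable lborel (\<lambda>x. iexp (t * x) * of_real (u x))"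
        and iV: "integrable lborel (\<lambda>x. iexp (t * x) * of_real (v x))"
        using iu iv by (intro integrable_iexp_mult integrable_of_real; simp)+
      show ?thesis
        unfolding U_def V_def
          Bochner_Integration.integral_add[OF iU integrable_mult_right[OF iV]] by simp
    qed
    finally show ?thesis using zero by simp
  qed
  have cnj: "(CLINT x|lborel. iexp (- t * x) * of_real (h x)) = cnj (CLINT x|lborel. iexp (t * x) * of_real (h x))"
    for h :: "real \<Rightarrow> real" and t
  proof -
    have "iexp (- t * x) * of_real (h x) = cnj (iexp (t * x) * of_real (h x))" for x
      by (simp add: exp_cnj)
    then show ?thesis by (simp only: Bochner_Integration.integral_cnj)
  qed
  have "U t = 0 \<and> V t = 0" for t
  proof -
    have "cnj (U (- t) + \<i> * V (- t)) = 0" using sum0 by simp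
    then have "U t - \<i> * V t = 0"
      using cnj[of t u] cnj[of t v] by (simp add: U_def V_def)
    with sum0[of t] show ?thesis by (auto simp: complex_eq_iff)
  qed
  then have "AE x in lborel. u x = 0" "AE x in lborel. v x = 0"
    using real_function_zero_of_transform_zero[OF iu] real_function_zero_of_transform_zero[OF iv]
    by (auto simp: U_def V_def)
  then have "AE x in lebesgue. u x = 0" "AE x in lebesgue. v x = 0"
    by (auto intro: AE_completion)
  with uv show ?thesis by eventually_elim (simp add: complex_eq_iff)
qed

section \<open>Gaps and sparse spectra\<close>

text \<open>
  The left side of the inequality equals \<open>2\<close> only when \<open>x - c\<close> is a multiple of \<open>T\<close>. With \<open>c\<close> the
  midpoint of a gap, points of \<open>S\<close> keep a positive distance \<open>T * \<delta>\<close> from \<open>c + \<int> * T\<close>.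
\<close>
lemma periodic_gaps_cos_bound:
  assumes "has_periodic_gaps S"
  shows "\<exists>T s c. T > 0 \<and> 1 \<le> s \<and> s < 2 \<and> (\<forall>x\<in>S. cmod (1 + cis (- 2 * pi * (x - c) / T)) \<le> s)"
proof -
  obtain I T where I: "is_interval I" "emeasure lebesgue I > 0" and T: "T > 0"
    and gap: "\<And>k::int. (\<lambda>x. x + of_int k * T) ` I \<subseteq> - S"
    using assms unfolding has_periodic_gaps_def by auto
  obtain a b where ab: "a \<in> I" "b \<in> I" "a < b"
  proof -
    have "\<exists>a\<in>I. \<exists>b\<in>I. a \<noteq> b"
    proof (rule ccontr)
      assume "\<not> ?thesis"
      then have "I = {} \<or> (\<exists>a. I = {a})" by blast
      then have "finite I" by auto
      then have "emeasure lebesgue I = 0"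
        using negligible_finite[of I] negligible_iff_null_sets by auto
      then show False using I by simp
    qed
    then show thesis using that by (metis linorder_neqE_linordered_idom)
  qed
  define c where "c = (a + b) / 2"
  define \<delta> where "\<delta> = min ((b - a) / (2 * T)) (1/2)"
  have \<delta>: "0 < \<delta>" "\<delta> \<le> 1/2" using ab T by (auto simp: \<delta>_def)
  define s where "s = max 1 (sqrt (2 + 2 * cos (2 * pi * \<delta>)))"
  have cos_lt: "cos (2 * pi * \<delta>) < 1"
    using cos_monotone_0_pi[of 0 "2 * pi * \<delta>"] \<delta> by simp
  show ?thesis
  proof (rule exI[of _ T], rule exI[of _ s], rule exI[of _ c], intro conjI ballI T)
    show "1 \<le> s" by (simp add: s_def)
    have "sqrt (2 + 2 * cos (2 * pi * \<delta>)) < 2"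
      using cos_lt by (intro real_less_lsqrt) auto
    then show "s < 2" by (simp add: s_def)
    fix x assume x: "x \<in> S"
    define y where "y = (x - c) / T"
    define k where "k = round y"
    define z where "z = y - of_int k"
    have z: "\<bar>z\<bar> \<le> 1/2" using of_int_round_abs_le[of y] by (simp add: z_def k_def abs_minus_commute)
    have "\<bar>z\<bar> \<ge> \<delta>"
    proof (rule ccontr)
      assume "\<not> \<bar>z\<bar> \<ge> \<delta>"
      then have "\<bar>z\<bar> < (b - a) / (2 * T)" by (auto simp: \<delta>_def)
      then have "\<bar>z\<bar> * T < (b - a) / 2" using T by (simp add: field_simps)
      then have "\<bar>z * T\<bar> < (b - a) / 2" using T by (simp add: abs_mult)
      moreover have zx: "x - of_int k * T = c + z * T" using T by (simp add: z_def y_def field_simps)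
      ultimately have "a \<le> x - of_int k * T" "x - of_int k * T \<le> b"
        unfolding zx by (simp_all add: c_def abs_less_iff field_simps)
      then have "x - of_int k * T \<in> I" using I(1) ab by (meson mem_is_interval_1_I)
      then have "x \<in> (\<lambda>x. x + of_int k * T) ` I" by (force simp: image_iff)
      then show False using gap x by auto
    qed
    have "cos (2 * pi * (x - c) / T) = cos (2 * pi * z + 2 * pi * of_int k)"
      by (simp add: z_def y_def algebra_simps)
    also have "\<dots> = cos (2 * pi * z)" by (simp add: cos_add cos_int_2pin sin_int_2pin)
    also have "\<dots> = cos (2 * pi * \<bar>z\<bar>)" by (cases "z \<ge> 0") auto
    also have "\<dots> \<le> cos (2 * pi * \<delta>)"
      using z \<delta> \<open>\<bar>z\<bar> \<ge> \<delta>\<close> by (intro cos_monotone_0_pi_le) auto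
    finally have le: "cos (2 * pi * (x - c) / T) \<le> cos (2 * pi * \<delta>)" .
    have "(cmod (1 + cis (- 2 * pi * (x - c) / T)))\<^sup>2 = 2 + 2 * cos (2 * pi * (x - c) / T)"
    proof -
      define \<theta> where "\<theta> = 2 * pi * (x - c) / T"
      have "- 2 * pi * (x - c) / T = - \<theta>" by (simp add: \<theta>_def)
      moreover have "(cmod (1 + cis (- \<theta>)))\<^sup>2 = 2 + 2 * cos \<theta>"
        using sin_cos_squared_add[of \<theta>]
        unfolding cmod_power2 by (simp add: power2_eq_square algebra_simps)
      ultimately show ?thesis by (simp only: \<theta>_def)
    qed
    also have "\<dots> \<le> 2 + 2 * cos (2 * pi * \<delta>)" using le by simp
    finally show "cmod (1 + cis (- 2 * pi * (x - c) / T)) \<le> s"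
      unfolding s_def using real_le_rsqrt by fastforce
  qed
qed

text \<open>
  A nonzero value at \<open>t0\<close> would persist, up to a factor \<open>1 / 2\<close>, on an interval around \<open>t0\<close>. That
  interval contains for each large \<open>N\<close> a point \<open>t\<close>, depending on \<open>N\<close>, whose lattice \<open>t + \<int> / T\<close> meets the
  spectrum rarely enough for the sample bound to force exponential decay in \<open>N\<close>.
\<close>
lemma fourier_integral_zero_of_sparse_spectrum:
  assumes f: "integrable lebesgue f"
    and T: "T > 0"
    and s: "1 \<le> s" "s < 2" "AE x in lebesgue. f x \<noteq> 0 \<longrightarrow> cmod (1 + cis (- 2 * pi * (x - c) / T)) \<le> s"
    and sparse: "density_zero (supp (fourier_integral f))"
  shows "fourier_integral f t0 = 0"
proof (rule ccontr)
  define F where "F = fourier_integral f"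
  define P where "P = supp F"
  assume "fourier_integral f t0 \<noteq> 0"
  then have F0: "cmod (F t0) > 0" by (simp add: F_def)
  have cont: "isCont F t" for t unfolding F_def by (rule isCont_fourier_integral[OF f])
  have P: "P \<in> sets lebesgue"
    using open_supp_fourier_integral[OF f] by (simp add: P_def F_def)
  have "\<forall>\<^sub>F t in at t0. dist (F t) (F t0) < cmod (F t0) / 2"
    using cont[of t0] F0 unfolding isCont_def by (intro tendstoD) auto
  then obtain d where d: "d > 0" "\<And>t. t \<noteq> t0 \<Longrightarrow> dist t t0 < d \<Longrightarrow> dist (F t) (F t0) < cmod (F t0) / 2"
    by (auto simp: eventually_at)
  \<comment> \<open>The second bound keeps the translates of the interval by multiples of \<open>1 / T\<close> disjoint.\<close>
  define \<eta> where "\<eta> = min d (1 / (2 * T))"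
  have \<eta>: "\<eta> > 0" "2 * \<eta> \<le> 1 / T" using d T by (auto simp: \<eta>_def min_def field_simps)
  have big: "cmod (F t) \<ge> cmod (F t0) / 2" if "t \<in> {t0 - \<eta><..<t0 + \<eta>}" for t
  proof (cases "t = t0")
    case False
    have "dist (F t) (F t0) < cmod (F t0) / 2"
      using that False by (intro d) (auto simp: dist_real_def \<eta>_def)
    then show ?thesis using norm_triangle_ineq2[of "F t0" "F t"] by (simp add: dist_norm norm_minus_commute)
  qed simp
  obtain \<epsilon> q :: real where \<epsilon>: "0 < \<epsilon>" and q: "0 < q" "q < 1"
    and decay: "\<And>N k::nat. real k \<le> \<epsilon> * real N \<Longrightarrow> (8 * real N) ^ k / fact k * ((s/2)\<^sup>2) ^ N \<le> q ^ N"
    using sparse_factor_subexponential[of "(s/2)\<^sup>2"] s by (auto simp: power_less_one_iff)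
  define L where "L = (LINT x|lebesgue. cmod (f x))"
  have L: "L \<ge> 0" by (simp add: L_def)
  have "\<forall>\<^sub>F N in sequentially. \<exists>t\<in>{t0 - \<eta><..<t0 + \<eta>}.
           real (card {j\<in>{..2*N}. t + (real j - real N) / T \<in> P}) \<le> \<epsilon> * real N"
    using P sparse T \<epsilon> \<eta> by (intro density_zero_sparse_sample) (auto simp: P_def F_def)
  moreover have "\<forall>\<^sub>F N::nat in sequentially. N > 0" by (rule eventually_gt_at_top)
  ultimately have ev: "\<forall>\<^sub>F N in sequentially. cmod (F t0) / 2 \<le> 2 * real N * q ^ N * L"
  proof eventually_elim
    case (elim N)
    then obtain t where t: "t \<in> {t0 - \<eta><..<t0 + \<eta>}"
      and card: "real (card {j\<in>{..2*N}. t + (real j - real N) / T \<in> P}) \<le> \<epsilon> * real N" by auto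
    define A where "A = {j\<in>{..2*N}. j \<noteq> N \<and> t + (real j - real N) / T \<in> P}"
    have "card A \<le> card {j\<in>{..2*N}. t + (real j - real N) / T \<in> P}"
      by (intro card_mono) (auto simp: A_def)
    with card have k: "real (card A) \<le> \<epsilon> * real N" by linarith
    have bound: "fact (card A) * real (2*N choose N) * cmod (F t) \<le> (8 * real N) ^ card A * s ^ (2*N) * L"
      unfolding F_def L_def
      by (rule fourier_sample_bound[OF f T s(1,3)]) (auto simp: A_def P_def supp_def F_def)
    have "4 ^ N / (2 * real N) \<le> real (2*N choose N)"
      using central_binomial_lower_bound elim by auto
    then have "fact (card A) * (4 ^ N / (2 * real N)) * cmod (F t) \<le> fact (card A) * real (2*N choose N) * cmod (F t)"
      by (intro mult_right_mono mult_left_mono) auto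
    also note bound
    finally have "cmod (F t) \<le> 2 * real N * ((8 * real N) ^ card A / fact (card A) * (s ^ (2*N) / 4 ^ N)) * L"
      using elim by (simp add: field_simps)
    also have "s ^ (2*N) / 4 ^ N = ((s/2)\<^sup>2) ^ N"
      by (simp add: power_mult power_divide)
    also have "2 * real N * ((8 * real N) ^ card A / fact (card A) * ((s/2)\<^sup>2) ^ N) * L \<le> 2 * real N * q ^ N * L"
      using decay[OF k] L by (intro mult_right_mono mult_left_mono) auto
    finally show ?case using big[OF t] by linarith
  qed
  have "(\<lambda>N. 2 * real N * q ^ N * L) \<longlonglongrightarrow> 2 * 0 * L"
    using powser_times_n_limit_0[of q] q
    by (subst mult.assoc[of 2]) (intro tendsto_mult tendsto_const, simp)
  then have "cmod (F t0) / 2 \<le> 2 * 0 * L"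
    using ev by (rule tendsto_lowerbound) simp
  with F0 show False by simp
qed

theorem theorem1:
  fixes S Q :: "real set"
  assumes "S \<in> sets lebesgue"
    and "emeasure lebesgue S < \<infinity>"
    and "has_periodic_gaps S"
    and "Q \<in> sets lebesgue"
    and "density_zero Q"
  shows "weakly_annihilating S Q"
  unfolding weakly_annihilating_def
proof (intro allI impI, elim conjE)
  fix f assume f2: "square_integrable f" and S: "ae_subset (supp f) S" and Q: "ae_subset (spec f) Q"
  have meas: "f \<in> borel_measurable lebesgue" and sq: "integrable lebesgue (\<lambda>x. (cmod (f x))\<^sup>2)"
    using f2 by (auto simp: square_integrable_def)
  have AE_S: "AE x in lebesgue. f x \<noteq> 0 \<longrightarrow> x \<in> S"
    using S AE_not_in[of "supp f - S" lebesgue] by (auto simp: ae_subset_def supp_def)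
  have f: "integrable lebesgue f"
  proof (rule Bochner_Integration.integrable_bound)
    show "integrable lebesgue (\<lambda>x. indicat_real S x + (cmod (f x))\<^sup>2)"
      using assms sq by (intro Bochner_Integration.integrable_add integrable_real_indicator) auto
    show "AE x in lebesgue. norm (f x) \<le> norm (indicat_real S x + (cmod (f x))\<^sup>2)"
      using AE_S
    proof eventually_elim
      case (elim x)
      have "cmod (f x) \<le> 1 + (cmod (f x))\<^sup>2"
        using zero_le_power2[of "cmod (f x) - 1/2"] by (simp add: power2_eq_square algebra_simps)
      then show ?case using elim by (auto simp: indicator_def)
    qed
  qed (rule meas)
  have spec: "spec f = supp (fourier_integral f)" using f by (simp add: spec_def fourier_def)
  have "supp (fourier_integral f) \<in> sets lebesgue"
    using open_supp_fourier_integral[OF f] by simp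
  then have sparse: "density_zero (supp (fourier_integral f))"
    using assms(4) Q[unfolded spec] assms(5) by (rule density_zero_ae_subset)
  obtain T s c where T: "T > 0" and s: "1 \<le> s" "s < 2"
    and gap: "\<And>x. x \<in> S \<Longrightarrow> cmod (1 + cis (- 2 * pi * (x - c) / T)) \<le> s"
    using periodic_gaps_cos_bound[OF assms(3)] by blast
  have "AE x in lebesgue. f x \<noteq> 0 \<longrightarrow> cmod (1 + cis (- 2 * pi * (x - c) / T)) \<le> s"
    using AE_S by eventually_elim (blast intro: gap)
  then have "fourier_integral f \<xi> = 0" for \<xi>
    by (intro fourier_integral_zero_of_sparse_spectrum[OF f T s _ sparse])
  then show "AE x in lebesgue. f x = 0"
    by (intro AE_zero_of_fourier_integral_zero[OF f])
qed

end
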